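(* Let $\Omega\subset\mathbb R^n$ be an open set, let $X=(X_1,\dots,X_m)$ be a family of Lipschitz continuous vector fields in $\Omega$, and let $E\subset\mathbb R^n$ be a measurable set of locally finite $X$-perimeter in $\Omega$, with horizontal inward normal $\nu_E$. Suppose there are two sequences $(\Omega_h)_{h\ge1}$ and $(\nu_h)_{h\ge1}$ such that (i) each $\Omega_h\subset\Omega$ is open, $\Omega_h\Subset\Omega_{h+1}$ for all $h$, and $\bigcup_{h=1}^\infty\Omega_h=\Omega$; (ii) $\nu_h\in C^1(\Omega;\mathbb R^m)$ and $|\nu_h(x)|_{\mathbb R^m}\le 1$ for all $x\in\Omega$ and all $h$; (iii) $\mathrm{div}_X\,\nu_h=0$ in $\Omega_h$ for each $h$; (iv) $\nu_h(x)\to\nu_E(x)$ as $h\to\infty$ for $\|\partial E\|_X$-a.e. $x\in\Omega$. Then $E$ is a minimizer for the $X$-perimeter in $\Omega$.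
   Context: Vector fields: $X_j(x)=\sum_{i=1}^n c_{ij}(x)\partial_i$ with Lipschitz coefficients $c_{ij}$, $j=1,\dots,m$. $X$-divergence: for $\varphi=(\varphi_1,\dots,\varphi_m)$ of class $C^1$, $\mathrm{div}_X\varphi:=\sum_{j=1}^m X_j^*\varphi_j$, where $X_j^*$ is the formal adjoint of $X_j$ in $L^2(\mathbb R^n)$, i.e. $X_j^*f=-\sum_i\partial_i(c_{ij}f)$ (defined a.e.). $X$-perimeter: for a measurable set $E\subset\mathbb R^n$ and an open set $U$, $\|\partial E\|_X(U):=\sup\{\int_E\mathrm{div}_X\varphi\,d\mathcal L^n:\ \varphi\in C^1_c(U;\mathbb R^m),\ |\varphi|\le1\}$. $E$ has locally finite $X$-perimeter in $\Omega$ if $\|\partial E\|_X(\Omega')<\infty$ for every open $\Omega'\Subset\Omega$; then $\|\partial E\|_X$ extends to a Radon measure on $\Omega$. Horizontal inward normal: the ($\|\partial E\|_X$-a.e. unique) $\|\partial E\|_X$-measurable function $\nu_E:\Omega\to\mathbb R^m$ with $|\nu_E|=1$ $\|\partial E\|_X$-a.e. in $\Omega$ and $\int_E\mathrm{div}_X\varphi\,d\mathcal L^n=-\int_\Omega\langle\varphi,\nu_E\rangle_{\mathbb R^m}\,d\|\partial E\|_X$ for all $\varphi\in C^1_c(\Omega;\mathbb R^m)$. Minimizer: $E$ is a minimizer for the $X$-perimeter in $\Omega$ if $\|\partial E\|_X(\Omega')\le\|\partial F\|_X(\Omega')$ for every open set $\Omega'\Subset\Omega$ and every measurable $F\subset\mathbb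 R^n$ with $E\Delta F\Subset\Omega'$. Notation: $U\Subset V$ means that the closure of $U$ is compact and contained in $V$. *)

theory Defs
  imports "HOL-Analysis.Analysis"
begin

definition compactly_contained :: "'a::topological_space set \<Rightarrow> 'a set \<Rightarrow> bool"
  where "compactly_contained U V \<longleftrightarrow> compact (closure U) \<and> closure U \<subseteq> V"

text \<open>Only used for open \<^term>\<open>S\<close>.\<close>

definition C1_on :: "'a::real_normed_vector set \<Rightarrow> ('a \<Rightarrow> 'b::real_normed_vector) \<Rightarrow> bool"
  where "C1_on S f \<longleftrightarrow> (\<exists>f' :: 'a \<Rightarrow> 'a \<Rightarrow>\<^sub>L 'b.
    (\<forall>x\<in>S. (f has_derivative blinfun_apply (f' x)) (at x)) \<and> continuous_on S f')"

text \<open>Functions in \<open>C\<^sup>1\<^sub>c(U)\<close> are extended by zero to the whole space.\<close>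

definition C1c :: "'a::real_normed_vector set \<Rightarrow> ('a \<Rightarrow> 'b::real_normed_vector) set"
  where "C1c U = {\<phi>. C1_on UNIV \<phi> \<and> compactly_contained {x. \<phi> x \<noteq> 0} U}"

text \<open>The partial derivative in direction \<open>i\<close>. A locally Lipschitz function has one almost
  everywhere; on the exceptional null set the value is set to \<open>0\<close>.\<close>

definition partial_deriv :: "'n::finite \<Rightarrow> (real^'n \<Rightarrow> real) \<Rightarrow> real^'n \<Rightarrow> real"
  where "partial_deriv i f x =
    (let g = (\<lambda>t. f (x + t *\<^sub>R axis i 1)) in
     if g differentiable (at 0) then deriv g 0 else 0)"

text \<open>A vector field \<open>Y = \<Sum>\<^sub>i c\<^sub>i \<partial>\<^sub>i\<close> is represented by the map \<open>x \<mapsto> (c\<^sub>i(x))\<^sub>i\<close>, and a family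
  \<open>X\<^sub>1, \<dots>, X\<^sub>m\<close> by a function on the index type, so that \<open>c\<^sub>i\<^sub>j(x)\<close> is \<^term>\<open>X j x $ i\<close>.\<close>

definition formal_adjoint ::
  "(real^'n::finite \<Rightarrow> real^'n) \<Rightarrow> (real^'n \<Rightarrow> real) \<Rightarrow> real^'n \<Rightarrow> real"
  where "formal_adjoint Y f x = - (\<Sum>i\<in>UNIV. partial_deriv i (\<lambda>y. Y y $ i * f y) x)"

text \<open>Note the sign: \<open>X\<^sub>j\<^sup>*\<close> carries a minus, so for \<open>X\<^sub>j = \<partial>\<^sub>j\<close> this is minus the usual divergence.\<close>

definition X_div ::
  "('m::finite \<Rightarrow> real^'n::finite \<Rightarrow> real^'n) \<Rightarrow> (real^'n \<Rightarrow> real^'m) \<Rightarrow> real^'n \<Rightarrow> real"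
  where "X_div X \<phi> x = (\<Sum>j\<in>UNIV. formal_adjoint (X j) (\<lambda>y. \<phi> y $ j) x)"

text \<open>Truncating the integrals at \<open>0\<close> by \<^const>\<open>ennreal\<close> does not change the supremum, since
  \<open>\<phi> = 0\<close> is admissible.\<close>

definition X_perimeter ::
  "('m::finite \<Rightarrow> real^'n::finite \<Rightarrow> real^'n) \<Rightarrow> (real^'n) set \<Rightarrow> (real^'n) set \<Rightarrow> ennreal"
  where "X_perimeter X E U =
    (SUP \<phi>\<in>{\<phi> \<in> C1c U. \<forall>x. norm (\<phi> x) \<le> 1}. ennreal (LINT x:E|lebesgue. X_div X \<phi> x))"

definition locally_finite_X_perimeter ::
  "('m::finite \<Rightarrow> real^'n::finite \<Rightarrow> real^'n) \<Rightarrow> (real^'n) set \<Rightarrow> (real^'n) set \<Rightarrow> bool"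
  where "locally_finite_X_perimeter X \<Omega> E \<longleftrightarrow>
    (\<forall>\<Omega>'. open \<Omega>' \<and> compactly_contained \<Omega>' \<Omega> \<longrightarrow> X_perimeter X E \<Omega>' < \<infinity>)"

text \<open>The Radon measure on \<open>\<Omega>\<close> extending the \<open>X\<close>-perimeter from open sets to Borel sets; being
  outer regular, it is given by the infimum below, which is countably additive on Borel sets as
  soon as \<open>E\<close> has locally finite \<open>X\<close>-perimeter in \<open>\<Omega>\<close>. The completion is taken so that
  measurability with respect to it means measurability up to null sets.\<close>

definition X_perimeter_measure ::
  "('m::finite \<Rightarrow> real^'n::finite \<Rightarrow> real^'n) \<Rightarrow> (real^'n) set \<Rightarrow> (real^'n) set \<Rightarrow> (real^'n) measure"
  where "X_perimeter_measure X \<Omega> E =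
    completion (measure_of \<Omega> {B \<in> sets borel. B \<subseteq> \<Omega>}
      (\<lambda>B. INF U\<in>{U. open U \<and> B \<subseteq> U \<and> U \<subseteq> \<Omega>}. X_perimeter X E U))"

definition horizontal_inward_normal ::
  "('m::finite \<Rightarrow> real^'n::finite \<Rightarrow> real^'n) \<Rightarrow> (real^'n) set \<Rightarrow> (real^'n) set \<Rightarrow>
    (real^'n \<Rightarrow> real^'m) \<Rightarrow> bool"
  where "horizontal_inward_normal X \<Omega> E \<nu> \<longleftrightarrow>
    \<nu> \<in> borel_measurable (X_perimeter_measure X \<Omega> E) \<and>
    (AE x in X_perimeter_measure X \<Omega> E. norm (\<nu> x) = 1) \<and>
    (\<forall>\<phi>\<in>C1c \<Omega>. (LINT x:E|lebesgue. X_div X \<phi> x) =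
      - (LINT x|X_perimeter_measure X \<Omega> E. \<phi> x \<bullet> \<nu> x))"

definition X_perimeter_minimizer ::
  "('m::finite \<Rightarrow> real^'n::finite \<Rightarrow> real^'n) \<Rightarrow> (real^'n) set \<Rightarrow> (real^'n) set \<Rightarrow> bool"
  where "X_perimeter_minimizer X \<Omega> E \<longleftrightarrow>
    (\<forall>\<Omega>' F. open \<Omega>' \<and> compactly_contained \<Omega>' \<Omega> \<and> F \<in> sets lebesgue \<and>
       compactly_contained (sym_diff E F) \<Omega>' \<longrightarrow> X_perimeter X E \<Omega>' \<le> X_perimeter X F \<Omega>')"

end

theory Submission imports Defs begin

text \<open>Calibration argument. Given an admissible test field \<open>\<phi>\<close> and a competitor \<open>F\<close>, let
  \<open>\<eta>\<close> be a cutoff equal to \<open>1\<close> near the supports of \<open>\<phi>\<close> and of \<open>E \<Delta> F\<close>. Testing \<open>E\<close> with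
  \<open>-\<eta> \<nu>\<^sub>h\<close> and letting \<open>h \<rightarrow> \<infinity>\<close> recovers \<open>\<integral> \<eta> d\<parallel>\<partial>E\<parallel>\<^sub>X\<close>, which dominates the flux of \<open>\<phi>\<close> through
  \<open>\<partial>E\<close>. Since \<open>\<eta> \<nu>\<^sub>h\<close> is divergence free near \<open>E \<Delta> F\<close>, testing \<open>F\<close> instead of \<open>E\<close> gives the
  same value, and that value is at most the perimeter of \<open>F\<close>.\<close>

section \<open>Continuously differentiable functions\<close>

lemma C1_on_subset: "C1_on T f \<Longrightarrow> S \<subseteq> T \<Longrightarrow> C1_on S f"
  unfolding C1_on_def by (meson continuous_on_subset subset_eq)

lemma C1_on_continuous_on:
  assumes "C1_on S f" shows "continuous_on S f"
  using assms unfolding C1_on_def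
  by (metis continuous_at_imp_continuous_on has_derivative_continuous)

lemma C1_on_const: "C1_on S (\<lambda>x. c)"
  unfolding C1_on_def by (rule exI[of _ "\<lambda>x. 0"]) (auto simp: zero_blinfun.rep_eq)

lemma C1_on_cong_open:
  assumes "C1_on S f" "open S" "\<And>x. x \<in> S \<Longrightarrow> f x = g x"
  shows "C1_on S g"
  using assms unfolding C1_on_def by (metis has_derivative_transform_within_open)

lemma C1_on_add:
  assumes "C1_on S f" "C1_on S g" shows "C1_on S (\<lambda>x. f x + g x)"
proof -
  obtain f' g' where
    "\<forall>x\<in>S. (f has_derivative blinfun_apply (f' x)) (at x)" "continuous_on S f'"
    "\<forall>x\<in>S. (g has_derivative blinfun_apply (g' x)) (at x)" "continuous_on S g'"
    using assms unfolding C1_on_def by blast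
  then show ?thesis unfolding C1_on_def
    by (intro exI[of _ "\<lambda>x. f' x + g' x"])
      (auto simp: plus_blinfun.rep_eq intro!: continuous_intros has_derivative_add)
qed

lemma C1_on_scaleR:
  assumes "C1_on S f" "C1_on S g" shows "C1_on S (\<lambda>x. f x *\<^sub>R g x)"
proof -
  obtain f' g' where d:
    "\<forall>x\<in>S. (f has_derivative blinfun_apply (f' x)) (at x)" "continuous_on S f'"
    "\<forall>x\<in>S. (g has_derivative blinfun_apply (g' x)) (at x)" "continuous_on S g'"
    using assms unfolding C1_on_def by blast
  \<comment> \<open>The product rule, with derivatives kept as bounded operators so that continuity
    is meant in the operator norm.\<close>
  let ?D = "\<lambda>x. f x *\<^sub>R g' x + (blinfun_scaleR_left (g x) o\<^sub>L f' x)"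
  have "continuous_on S ?D"
    using d C1_on_continuous_on[OF assms(1)] C1_on_continuous_on[OF assms(2)]
    by (intro continuous_intros) auto
  moreover have "((\<lambda>x. f x *\<^sub>R g x) has_derivative blinfun_apply (?D x)) (at x)" if "x \<in> S" for x
  proof -
    have "blinfun_apply (?D x) = (\<lambda>h. f x *\<^sub>R blinfun_apply (g' x) h + blinfun_apply (f' x) h *\<^sub>R g x)"
      by (auto simp: plus_blinfun.rep_eq scaleR_blinfun.rep_eq)
    then show ?thesis using d that by (simp only: has_derivative_scaleR)
  qed
  ultimately show ?thesis unfolding C1_on_def by (intro exI[of _ ?D]) blast
qed

lemma C1_on_compose:
  assumes "C1_on UNIV g" "C1_on S f" shows "C1_on S (\<lambda>x. g (f x))"
proof -
  obtain f' g' where d: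
    "\<forall>x\<in>S. (f has_derivative blinfun_apply (f' x)) (at x)" "continuous_on S f'"
    "\<forall>x. (g has_derivative blinfun_apply (g' x)) (at x)" "continuous_on UNIV g'"
    using assms unfolding C1_on_def by blast
  let ?D = "\<lambda>x. g' (f x) o\<^sub>L f' x"
  have "continuous_on S (\<lambda>x. g' (f x))"
    using continuous_on_compose2[OF d(4) C1_on_continuous_on[OF assms(2)]] by simp
  then have "continuous_on S ?D"
    using d by (intro continuous_intros) auto
  moreover have "((\<lambda>x. g (f x)) has_derivative blinfun_apply (?D x)) (at x)" if "x \<in> S" for x
  proof -
    have "blinfun_apply (?D x) = (\<lambda>h. blinfun_apply (g' (f x)) (blinfun_apply (f' x) h))"
      by auto
    then show ?thesis
      using has_derivative_compose[of f "blinfun_apply (f' x)" x UNIV g] d that by simp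
  qed
  ultimately show ?thesis unfolding C1_on_def by (intro exI[of _ ?D]) blast
qed

text \<open>Uniqueness of the derivative makes the two candidates agree on the overlap, so the glued
  derivative is continuous on each of the two open sets and hence on their union.\<close>

lemma C1_on_Un:
  assumes "C1_on A f" "C1_on B f" "open A" "open B" shows "C1_on (A \<union> B) f"
proof -
  obtain a b where d:
    "\<forall>x\<in>A. (f has_derivative blinfun_apply (a x)) (at x)" "continuous_on A a"
    "\<forall>x\<in>B. (f has_derivative blinfun_apply (b x)) (at x)" "continuous_on B b"
    using assms unfolding C1_on_def by blast
  define D where "D x = (if x \<in> A then a x else b x)" for x
  have DB: "D x = b x" if "x \<in> B" for x
    using d that has_derivative_unique[of f "blinfun_apply (a x)" x "blinfun_apply (b x)"]
    by (auto simp: D_def blinfun_apply_inject)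
  have "continuous_on A D" using d(2) by (rule continuous_on_eq) (simp add: D_def)
  moreover have "continuous_on B D" using d(4) by (rule continuous_on_eq) (simp add: DB)
  ultimately have "continuous_on (A \<union> B) D"
    using assms by (intro continuous_on_open_Un) auto
  moreover have "\<forall>x\<in>A \<union> B. (f has_derivative blinfun_apply (D x)) (at x)"
    using d DB by (auto simp: D_def)
  ultimately show ?thesis unfolding C1_on_def by blast
qed

section \<open>Concrete functions from which cutoffs are built\<close>

lemma C1_on_real:
  fixes f :: "real \<Rightarrow> real"
  assumes "\<And>x. (f has_real_derivative f' x) (at x)" "continuous_on UNIV f'"
  shows "C1_on UNIV f"
proof -
  have "(f has_derivative blinfun_apply (blinfun_mult_right (f' x))) (at x)" for x
    using assms(1) by (simp add: has_field_derivative_def blinfun_mult_right.rep_eq)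
  moreover have "continuous_on UNIV (\<lambda>x. blinfun_mult_right (f' x))"
    using assms(2) by (intro continuous_intros)
  ultimately show ?thesis
    unfolding C1_on_def by (intro exI[of _ "\<lambda>x. blinfun_mult_right (f' x)"]) blast
qed

lemma C1_on_norm_diff_sq:
  fixes a :: "'a::real_inner"
  shows "C1_on UNIV (\<lambda>x. (norm (x - a))\<^sup>2)"
proof -
  let ?D = "\<lambda>x. 2 *\<^sub>R blinfun_inner_right (x - a)"
  have "((\<lambda>x. (norm (x - a))\<^sup>2) has_derivative blinfun_apply (?D x)) (at x)" for x
    unfolding power2_norm_eq_inner
    by (rule derivative_eq_intros refl)+
      (auto simp: scaleR_blinfun.rep_eq blinfun_inner_right.rep_eq inner_commute fun_eq_iff)
  moreover have "continuous_on UNIV ?D" by (intro continuous_intros)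
  ultimately show ?thesis
    unfolding C1_on_def by (intro exI[of _ ?D]) blast
qed

text \<open>Squaring removes the kink of the positive part at \<open>0\<close>. Truncations by this
  function are the building blocks of the cutoffs.\<close>

lemma C1_on_max_0_sq: "C1_on UNIV (\<lambda>t::real. (max 0 t)\<^sup>2)"
proof (rule C1_on_real)
  fix x :: real
  consider "x < 0" | "x = 0" | "x > 0" by linarith
  then show "((\<lambda>t. (max 0 t)\<^sup>2) has_real_derivative 2 * max 0 x) (at x)"
  proof cases
    case 1
    have "((\<lambda>t. 0) has_real_derivative 2 * max 0 x) (at x)" using 1 by auto
    then show ?thesis
      by (rule has_field_derivative_transform_within_open[of _ _ _ "{..<0}"]) (use 1 in auto)
  next
    case 2
    \<comment> \<open>At the kink the difference quotient is at most the absolute value of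
      \<open>h\<close>.\<close>
    have "((\<lambda>h. (max 0 h)\<^sup>2 / h) \<longlongrightarrow> 0) (at (0::real))"
    proof (rule Lim_null_comparison[of _ "\<lambda>h. \<bar>h\<bar>"])
      show "\<forall>\<^sub>F h in at (0::real). norm ((max 0 h)\<^sup>2 / h) \<le> \<bar>h\<bar>"
        by (auto simp: max_def power2_eq_square)
      show "((\<lambda>h. \<bar>h\<bar>) \<longlongrightarrow> 0) (at (0::real))"
        using tendsto_rabs_zero[OF tendsto_ident_at] .
    qed
    then show ?thesis using 2 by (simp add: DERIV_def)
  next
    case 3
    have "((\<lambda>t. t\<^sup>2) has_real_derivative 2 * max 0 x) (at x)"
      using 3 by (auto intro!: derivative_eq_intros)
    then show ?thesis
      by (rule has_field_derivative_transform_within_open[of _ _ _ "{0<..}"]) (use 3 in auto)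
  qed
qed (intro continuous_intros)

section \<open>Cutoff functions\<close>

lemma C1c_continuous: "\<phi> \<in> C1c U \<Longrightarrow> continuous_on UNIV \<phi>"
  by (simp add: C1c_def C1_on_continuous_on)

lemma C1c_mono: "\<phi> \<in> C1c U \<Longrightarrow> U \<subseteq> V \<Longrightarrow> \<phi> \<in> C1c V"
  by (auto simp: C1c_def compactly_contained_def)

lemma compactly_contained_subset:
  fixes S T :: "'a::t2_space set"
  assumes "compactly_contained T U" "S \<subseteq> T" shows "compactly_contained S U"
  using assms closure_mono[of S T] unfolding compactly_contained_def
  by (metis closed_closure compact_Int_closed inf.absorb_iff2 order_trans)

lemma compactly_contained_Un:
  "compactly_contained S U \<Longrightarrow> compactly_contained T U \<Longrightarrow> compactly_contained (S \<union> T) U"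
  by (auto simp: compactly_contained_def compact_Un)

text \<open>The factor \<open>f\<close> is controlled on \<open>S\<close> only. The product vanishes
  off the closed support of \<open>\<eta>\<close>, and the complement of that support together with
  \<open>S\<close> covers the space, so the two local statements glue. This serves the fields
  \<open>\<nu> h\<close>, which are C1 on \<open>\<Omega>\<close> only.\<close>

lemma C1c_scaleR:
  fixes \<eta> :: "'a::real_normed_vector \<Rightarrow> real"
  assumes "\<eta> \<in> C1c U" "open S" "U \<subseteq> S" "C1_on S f"
  shows "(\<lambda>x. \<eta> x *\<^sub>R f x) \<in> C1c U"
proof -
  let ?K = "closure {x. \<eta> x \<noteq> 0}"
  have \<eta>: "C1_on UNIV \<eta>" and K: "compactly_contained {x. \<eta> x \<noteq> 0} U"
    using assms(1) by (auto simp: C1c_def)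
  have "C1_on S (\<lambda>x. \<eta> x *\<^sub>R f x)"
    using C1_on_scaleR[OF C1_on_subset[OF \<eta>] assms(4)] by simp
  moreover have "C1_on (- ?K) (\<lambda>x. \<eta> x *\<^sub>R f x)"
    using closure_subset[of "{x. \<eta> x \<noteq> 0}"]
    by (intro C1_on_cong_open[OF C1_on_const[of _ 0]]) (auto simp: open_Compl)
  ultimately have "C1_on (S \<union> - ?K) (\<lambda>x. \<eta> x *\<^sub>R f x)"
    using assms(2) by (intro C1_on_Un) auto
  moreover have "S \<union> - ?K = UNIV" using K assms(3) by (auto simp: compactly_contained_def)
  moreover have "compactly_contained {x. \<eta> x *\<^sub>R f x \<noteq> 0} U"
    by (rule compactly_contained_subset[OF K]) auto
  ultimately show ?thesis by (simp add: C1c_def)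
qed

lemma cutoff_ball:
  fixes a :: "'a::euclidean_space"
  assumes "open U" "a \<in> U"
  obtains r \<eta> where "r > 0" "\<eta> \<in> C1c U" "\<And>x. 0 \<le> \<eta> x \<and> \<eta> x \<le> (1::real)"
    "\<And>x. x \<in> ball a r \<Longrightarrow> \<eta> x = 1"
proof -
  obtain e where e: "e > 0" "cball a e \<subseteq> U" using assms open_contains_cball by blast
  define r where "r = e / 2"
  have r: "r > 0" using e by (simp add: r_def)
  \<comment> \<open>The profile \<open>p\<close> is at least \<open>1\<close> on
    \<open>ball a r\<close> and nonpositive where \<open>norm (x - a)\<close> is at least
    \<open>sqrt 2 * r\<close>, hence outside the ball of radius \<open>e = 2 * r\<close>.\<close>
  define p :: "'a \<Rightarrow> real" where "p x = 2 + (- 1 / r\<^sup>2) *\<^sub>R (norm (x - a))\<^sup>2" for x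
  \<comment> \<open>The inner truncation gives the value \<open>0\<close> once
    \<open>p x \<le> 0\<close>; the outer one gives exactly \<open>1\<close> once
    \<open>p x \<ge> 1\<close>.\<close>
  define \<eta> :: "'a \<Rightarrow> real" where "\<eta> x = 1 + (- 1) *\<^sub>R (max 0 (1 + (- 1) *\<^sub>R (max 0 (p x))\<^sup>2))\<^sup>2" for x
  have "C1_on UNIV p" unfolding p_def
    by (intro C1_on_add C1_on_scaleR C1_on_const C1_on_norm_diff_sq)
  then have C1: "C1_on UNIV \<eta>" unfolding \<eta>_def
    by (intro C1_on_add C1_on_scaleR C1_on_const C1_on_compose[OF C1_on_max_0_sq])
  have one: "\<eta> x = 1" if "x \<in> ball a r" for x
  proof -
    have "(norm (x - a))\<^sup>2 \<le> r\<^sup>2"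
      using that by (intro power_mono) (auto simp: dist_norm norm_minus_commute)
    then have "p x \<ge> 1" using r by (simp add: p_def field_simps)
    then have "(max 0 (p x))\<^sup>2 \<ge> 1" using one_le_power[of "p x" 2] by (simp add: max_def)
    then show ?thesis by (simp add: \<eta>_def)
  qed
  have supp: "x \<in> cball a e" if "\<eta> x \<noteq> 0" for x
  proof (rule ccontr)
    assume "x \<notin> cball a e"
    then have "2 * r < norm (x - a)" by (simp add: r_def dist_norm norm_minus_commute)
    then have "(2 * r)\<^sup>2 \<le> (norm (x - a))\<^sup>2" using r by (intro power_mono) auto
    then have "4 * r\<^sup>2 \<le> (norm (x - a))\<^sup>2" by (simp add: power_mult_distrib)
    then have "2 * r\<^sup>2 \<le> (norm (x - a))\<^sup>2" using zero_le_power2[of r] by linarith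
    then have "p x \<le> 0" using r by (simp add: p_def field_simps)
    then show False using that by (simp add: \<eta>_def)
  qed
  have "compactly_contained (cball a e) U" using e by (simp add: compactly_contained_def)
  then have "\<eta> \<in> C1c U"
    using C1 supp by (auto simp: C1c_def elim!: compactly_contained_subset)
  moreover have "0 \<le> \<eta> x \<and> \<eta> x \<le> 1" for x
  proof -
    have "max 0 (1 - (max 0 (p x))\<^sup>2) \<le> 1" by simp
    then have "(max 0 (1 - (max 0 (p x))\<^sup>2))\<^sup>2 \<le> 1" by (intro power_le_one) auto
    then show ?thesis by (simp add: \<eta>_def)
  qed
  ultimately show ?thesis using that r one by blast
qed

text \<open>Finitely many balls from \<open>cutoff_ball\<close> cover \<open>K\<close>, and their
  cutoffs are merged one by one. The value \<open>1\<close> is attained on an open neighbourhood of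
  \<open>K\<close>, so that near \<open>K\<close> the cutoff does not affect derivatives.\<close>

lemma C1_cutoff:
  fixes K :: "'a::euclidean_space set"
  assumes "compact K" "open U" "K \<subseteq> U"
  obtains V \<eta> where "open V" "K \<subseteq> V" "\<eta> \<in> C1c U" "\<And>x. 0 \<le> \<eta> x \<and> \<eta> x \<le> (1::real)"
    "\<And>x. x \<in> V \<Longrightarrow> \<eta> x = 1"
proof -
  have "\<forall>a\<in>K. \<exists>r>0. \<exists>\<eta>\<in>C1c U. (\<forall>x. 0 \<le> \<eta> x \<and> \<eta> x \<le> (1::real)) \<and> (\<forall>x\<in>ball a r. \<eta> x = 1)"
    using cutoff_ball[OF assms(2)] assms(3) by (metis subsetD)
  then obtain r where r: "\<And>a. a \<in> K \<Longrightarrow> r a > 0"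
    "\<And>a. a \<in> K \<Longrightarrow> \<exists>\<eta>\<in>C1c U. (\<forall>x. 0 \<le> \<eta> x \<and> \<eta> x \<le> (1::real)) \<and> (\<forall>x\<in>ball a (r a). \<eta> x = 1)"
    by metis
  obtain C where C: "C \<subseteq> K" "finite C" "K \<subseteq> (\<Union>a\<in>C. ball a (r a))"
    by (rule compactE_image[OF assms(1), of K "\<lambda>a. ball a (r a)"]) (use r in force)+
  have "\<exists>\<eta>\<in>C1c U. (\<forall>x. 0 \<le> \<eta> x \<and> \<eta> x \<le> (1::real)) \<and> (\<forall>x\<in>\<Union>a\<in>C. ball a (r a). \<eta> x = 1)"
    using C(2) C(1)
  proof (induction C rule: finite_induct)
    case empty
    have "(\<lambda>x. 0) \<in> C1c U" by (simp add: C1c_def C1_on_const compactly_contained_def)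
    then show ?case by (intro bexI[of _ "\<lambda>x. 0"]) auto
  next
    case (insert a C)
    obtain f where f: "f \<in> C1c U" "\<forall>x. 0 \<le> f x \<and> f x \<le> (1::real)"
      "\<forall>x\<in>\<Union>a\<in>C. ball a (r a). f x = 1"
      using insert by auto
    obtain g where g: "g \<in> C1c U" "\<forall>x. 0 \<le> g x \<and> g x \<le> (1::real)" "\<forall>x\<in>ball a (r a). g x = 1"
      using r(2)[of a] insert.prems by auto
    \<comment> \<open>This is \<open>1 - (1 - f x) * (1 - g x)\<close>, which stays between
      \<open>0\<close> and \<open>1\<close> and equals \<open>1\<close> wherever \<open>f\<close> or
      \<open>g\<close> does. It is arranged as sums and products to suit the C1 rules.\<close>
    define h where "h x = f x + (1 + (- 1) *\<^sub>R f x) *\<^sub>R g x" for x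
    have h: "h x = 1 - (1 - f x) * (1 - g x)" for x by (simp add: h_def algebra_simps)
    have "C1_on UNIV h" using f(1) g(1) unfolding h_def C1c_def
      by (intro C1_on_add C1_on_scaleR C1_on_const) auto
    moreover have "compactly_contained ({x. f x \<noteq> 0} \<union> {x. g x \<noteq> 0}) U"
      using f(1) g(1) by (intro compactly_contained_Un) (auto simp: C1c_def)
    then have "compactly_contained {x. h x \<noteq> 0} U"
      by (rule compactly_contained_subset) (auto simp: h_def)
    ultimately have "h \<in> C1c U" by (simp add: C1c_def)
    moreover have "0 \<le> h x \<and> h x \<le> 1" for x
      using f(2) g(2) mult_le_one[of "1 - f x" "1 - g x"] by (simp add: h)
    moreover have "\<forall>x\<in>\<Union>a\<in>insert a C. ball a (r a). h x = 1"
      using f(3) g(3) by (auto simp: h)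
    ultimately show ?case by (intro bexI[of _ h]) auto
  qed
  then obtain \<eta> where "\<eta> \<in> C1c U" "\<forall>x. 0 \<le> \<eta> x \<and> \<eta> x \<le> (1::real)"
    "\<forall>x\<in>\<Union>a\<in>C. ball a (r a). \<eta> x = 1" by blast
  then show ?thesis using that[of "\<Union>a\<in>C. ball a (r a)" \<eta>] C by blast
qed

section \<open>The horizontal divergence\<close>

lemma partial_deriv_cong_open:
  assumes "open V" "x \<in> V" "\<And>y. y \<in> V \<Longrightarrow> f y = g y"
  shows "partial_deriv i f x = partial_deriv i g x"
proof -
  have "((\<lambda>t. x + t *\<^sub>R axis i 1) \<longlongrightarrow> x + 0 *\<^sub>R axis i 1) (nhds (0::real))"
    by (intro tendsto_intros filterlim_ident)
  then have "\<forall>\<^sub>F t in nhds 0. x + t *\<^sub>R axis i 1 \<in> V"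
    using assms(1,2) by (auto dest: topological_tendstoD)
  then have ev: "\<forall>\<^sub>F t in nhds 0. f (x + t *\<^sub>R axis i 1) = g (x + t *\<^sub>R axis i 1)"
    by eventually_elim (rule assms(3))
  \<comment> \<open>Having the equivalence for every \<open>D\<close> transfers the existence of the
    derivative as well as its value, so both sides fall back to the default \<open>0\<close> at the
    same points.\<close>
  have "DERIV (\<lambda>t. f (x + t *\<^sub>R axis i 1)) 0 :> D \<longleftrightarrow> DERIV (\<lambda>t. g (x + t *\<^sub>R axis i 1)) 0 :> D" for D
    by (rule DERIV_cong_ev[OF refl ev refl])
  then show ?thesis
    unfolding partial_deriv_def Let_def deriv_def real_differentiable_def by simp
qed

text \<open>The identity holds at every point: a change of sign preserves differentiability, and the
  default value \<open>0\<close> is its own negative.\<close>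

lemma partial_deriv_minus: "partial_deriv i (\<lambda>y. - f y) x = - partial_deriv i f x"
proof -
  let ?g = "\<lambda>t. f (x + t *\<^sub>R axis i 1)"
  have iff: "(\<lambda>t. - ?g t) differentiable at 0 \<longleftrightarrow> ?g differentiable at 0"
    using differentiable_minus[of ?g] differentiable_minus[of "\<lambda>t. - ?g t"] by auto
  have "deriv (\<lambda>t. - ?g t) 0 = - deriv ?g 0" if "?g differentiable at 0"
    using that by (intro DERIV_imp_deriv DERIV_minus) (simp add: DERIV_deriv_iff_real_differentiable)
  then show ?thesis using iff by (simp add: partial_deriv_def Let_def)
qed

text \<open>The divergence is local. A field multiplied by a cutoff therefore has the divergence of
  the original field wherever the cutoff is \<open>1\<close> in a neighbourhood.\<close>

lemma X_div_cong_open: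
  assumes "open V" "x \<in> V" "\<And>y. y \<in> V \<Longrightarrow> \<phi> y = \<psi> y"
  shows "X_div X \<phi> x = X_div X \<psi> x"
  unfolding X_div_def formal_adjoint_def
  by (intro sum.cong refl arg_cong[of _ _ uminus] partial_deriv_cong_open[OF assms(1,2)])
    (simp add: assms(3))

lemma X_div_minus: "X_div X (\<lambda>y. - \<phi> y) x = - X_div X \<phi> x"
  by (simp add: X_div_def formal_adjoint_def partial_deriv_minus sum_negf)

section \<open>The perimeter measure\<close>

lemma X_perimeter_upper:
  assumes "\<phi> \<in> C1c U" "\<And>x. norm (\<phi> x) \<le> 1"
  shows "ennreal (LINT x:E|lebesgue. X_div X \<phi> x) \<le> X_perimeter X E U"
  unfolding X_perimeter_def by (rule SUP_upper) (use assms in auto)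

lemma space_X_perimeter_measure [simp]: "space (X_perimeter_measure X \<Omega> E) = \<Omega>"
  unfolding X_perimeter_measure_def by (simp add: space_measure_of_conv)

lemma sets_X_perimeter_measure:
  assumes "B \<in> sets borel" "B \<subseteq> \<Omega>"
  shows "B \<in> sets (X_perimeter_measure X \<Omega> E)"
  unfolding X_perimeter_measure_def
  by (intro sets_completionI_sets) (use assms in \<open>auto intro!: sigma_sets.Basic simp: sets_measure_of_conv\<close>)

lemma borel_measurable_X_perimeter_measure:
  fixes f :: "real^'n::finite \<Rightarrow> 'b::topological_space"
  assumes "open \<Omega>" "f \<in> borel_measurable borel"
  shows "f \<in> borel_measurable (X_perimeter_measure X \<Omega> E)"
proof (rule measurableI)
  fix A :: "'b set" assume "A \<in> sets borel"
  then have "f -` A \<in> sets borel" using assms(2) by (metis measurable_sets_borel)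
  then show "f -` A \<inter> space (X_perimeter_measure X \<Omega> E) \<in> sets (X_perimeter_measure X \<Omega> E)"
    using assms(1) by (auto intro!: sets_X_perimeter_measure)
qed simp

text \<open>Where the outer measure fails to be countably additive, \<^const>\<open>measure_of\<close> yields the zero
  measure, so the bound needs no additivity.\<close>

lemma emeasure_X_perimeter_measure_le:
  assumes "B \<in> sets borel" "B \<subseteq> U" "open U" "U \<subseteq> \<Omega>"
  shows "emeasure (X_perimeter_measure X \<Omega> E) B \<le> X_perimeter X E U"
proof -
  let ?M = "measure_of \<Omega> {B \<in> sets borel. B \<subseteq> \<Omega>}
      (\<lambda>B. INF U\<in>{U. open U \<and> B \<subseteq> U \<and> U \<subseteq> \<Omega>}. X_perimeter X E U)"
  have "B \<in> sets ?M" using assms by (auto intro!: sigma_sets.Basic simp: sets_measure_of_conv)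
  then have "emeasure (X_perimeter_measure X \<Omega> E) B = emeasure ?M B"
    unfolding X_perimeter_measure_def by simp
  also have "\<dots> \<le> (INF U\<in>{U. open U \<and> B \<subseteq> U \<and> U \<subseteq> \<Omega>}. X_perimeter X E U)"
    by (simp add: emeasure_measure_of_conv)
  also have "\<dots> \<le> X_perimeter X E U" by (rule INF_lower) (use assms in auto)
  finally show ?thesis .
qed

text \<open>The function is dominated by the indicator of its closed support. This support lies in
  \<open>U\<close>, where the perimeter of \<open>E\<close> is finite, so it has finite
  measure.\<close>

lemma integrable_C1c_X_perimeter_measure:
  fixes \<eta> :: "real^'n::finite \<Rightarrow> real"
  assumes "open \<Omega>" "locally_finite_X_perimeter X \<Omega> E"
    and U: "open U" "compactly_contained U \<Omega>"
    and \<eta>: "\<eta> \<in> C1c U" "\<And>x. 0 \<le> \<eta> x \<and> \<eta> x \<le> 1"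
  shows "integrable (X_perimeter_measure X \<Omega> E) \<eta>"
proof -
  let ?M = "X_perimeter_measure X \<Omega> E"
  define C where "C = closure {x. \<eta> x \<noteq> 0}"
  have U\<Omega>: "U \<subseteq> \<Omega>" using U closure_subset[of U] by (auto simp: compactly_contained_def)
  have C: "C \<subseteq> U" "C \<in> sets borel"
    using \<eta> by (auto simp: C1c_def compactly_contained_def C_def)
  have "emeasure ?M C \<le> X_perimeter X E U"
    using C U U\<Omega> by (intro emeasure_X_perimeter_measure_le) auto
  also have "\<dots> < \<infinity>" using assms(2) U by (auto simp: locally_finite_X_perimeter_def)
  finally have "emeasure ?M C < \<infinity>" .
  then have "integrable ?M (indicator C :: _ \<Rightarrow> real)"
    using C U\<Omega> by (intro integrable_real_indicator sets_X_perimeter_measure) auto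
  moreover have "\<eta> \<in> borel_measurable ?M"
    using assms(1) C1c_continuous[OF \<eta>(1)]
    by (intro borel_measurable_X_perimeter_measure borel_measurable_continuous_onI)
  moreover have "norm (\<eta> x) \<le> norm (indicator C x :: real)" for x
    using \<eta>(2)[of x] closure_subset[of "{x. \<eta> x \<noteq> 0}"]
    by (auto simp: C_def indicator_def)
  ultimately show ?thesis by (intro Bochner_Integration.integrable_bound[of ?M "indicator C" \<eta>]) auto
qed

text \<open>If one function is measurable, completeness makes the other one measurable too; if
  neither is, both integrals have the default value \<open>0\<close>. This form suits divergences,
  whose measurability is not established here.\<close>

lemma lebesgue_integral_cong_AE:
  fixes f g :: "'a::euclidean_space \<Rightarrow> 'b::euclidean_space"
  assumes "AE x in lebesgue. f x = g x"
  shows "integral\<^sup>L lebesgue f = integral\<^sup>L lebesgue g"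
proof (cases "f \<in> borel_measurable lebesgue")
  case True
  then show ?thesis using assms borel_measurable_AE[OF True assms] by (intro integral_cong_AE)
next
  case False
  have "AE x in lebesgue. g x = f x" using assms by (auto simp: eq_commute)
  then have "g \<notin> borel_measurable lebesgue" using False borel_measurable_AE by blast
  then show ?thesis using False by (metis borel_measurable_integrable not_integrable_integral_eq)
qed

text \<open>The sets increase from index \<open>1\<close> on, so the union of a finite subcover of
  \<open>K\<close> lies in \<open>W h\<close> for every \<open>h\<close> beyond all indices
  used.\<close>

lemma exhaustion_absorbs_compact:
  assumes "compact K" "K \<subseteq> (\<Union>h\<in>{1..}. W h)"
    and "\<And>h. h \<ge> 1 \<Longrightarrow> open (W h) \<and> W h \<subseteq> W (Suc h)"
  obtains h\<^sub>0::nat where "h\<^sub>0 \<ge> 1" "\<And>h. h \<ge> h\<^sub>0 \<Longrightarrow> K \<subseteq> W h"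
proof -
  have mono: "W i \<subseteq> W j" if "1 \<le> i" "i \<le> j" for i j
    using that(2)
  proof (induction j rule: dec_induct)
    case (step n)
    have "W n \<subseteq> W (Suc n)" using assms(3)[of n] that(1) step.hyps by simp
    then show ?case using step.IH by blast
  qed simp
  obtain C where C: "C \<subseteq> {1..}" "finite C" "K \<subseteq> (\<Union>h\<in>C. W h)"
    using assms by (meson atLeast_iff compactE_image)
  \<comment> \<open>Inserting \<open>1\<close> keeps the maximum meaningful when \<open>C\<close> is
    empty and ensures \<open>m \<ge> 1\<close>, where monotonicity starts.\<close>
  define m where "m = Max (insert 1 C)"
  have "K \<subseteq> W h" if "h \<ge> m" for h
  proof -
    have "W i \<subseteq> W h" if "i \<in> C" for i
      using mono[of i h] C that \<open>h \<ge> m\<close> Max_ge[of "insert 1 C" i] by (auto simp: m_def)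
    then show ?thesis using C by blast
  qed
  moreover have "m \<ge> 1" using C by (auto simp: m_def intro: Max_ge)
  ultimately show ?thesis using that by blast
qed

section \<open>Calibration by divergence-free fields\<close>

theorem theorem2p1:
  fixes \<Omega> E :: "(real^'n::finite) set"
    and X :: "'m::finite \<Rightarrow> real^'n \<Rightarrow> real^'n"
    and \<nu>\<^sub>E :: "real^'n \<Rightarrow> real^'m"
    and \<Omega>s :: "nat \<Rightarrow> (real^'n) set"
    and \<nu> :: "nat \<Rightarrow> real^'n \<Rightarrow> real^'m"
  assumes "open \<Omega>"
    and "\<And>j. \<exists>L. L-lipschitz_on \<Omega> (X j)"
    and "E \<in> sets lebesgue"
    and "locally_finite_X_perimeter X \<Omega> E"
    and "horizontal_inward_normal X \<Omega> E \<nu>\<^sub>E"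
    and "\<And>h. h \<ge> 1 \<Longrightarrow> \<Omega>s h \<subseteq> \<Omega> \<and> open (\<Omega>s h) \<and> compactly_contained (\<Omega>s h) (\<Omega>s (Suc h))"
    and "(\<Union>h\<in>{1..}. \<Omega>s h) = \<Omega>"
    and "\<And>h. h \<ge> 1 \<Longrightarrow> C1_on \<Omega> (\<nu> h) \<and> (\<forall>x\<in>\<Omega>. norm (\<nu> h x) \<le> 1)"
    and "\<And>h. h \<ge> 1 \<Longrightarrow> AE x in lebesgue. x \<in> \<Omega>s h \<longrightarrow> X_div X (\<nu> h) x = 0"
    and "AE x in X_perimeter_measure X \<Omega> E. (\<lambda>h. \<nu> h x) \<longlonglongrightarrow> \<nu>\<^sub>E x"
  shows "X_perimeter_minimizer X \<Omega> E"
proof -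
  let ?M = "X_perimeter_measure X \<Omega> E"
  have \<nu>E: "\<nu>\<^sub>E \<in> borel_measurable ?M" "AE x in ?M. norm (\<nu>\<^sub>E x) = 1"
    and Gauss: "\<And>\<phi>. \<phi> \<in> C1c \<Omega> \<Longrightarrow>
      (LINT x:E|lebesgue. X_div X \<phi> x) = - (LINT x|?M. \<phi> x \<bullet> \<nu>\<^sub>E x)"
    using assms(5) by (auto simp: horizontal_inward_normal_def)
  have meas: "(\<lambda>x. \<phi> x \<bullet> \<nu>\<^sub>E x) \<in> borel_measurable ?M" if "\<phi> \<in> C1c U" for \<phi> U
    by (intro borel_measurable_inner[OF _ \<nu>E(1)] borel_measurable_X_perimeter_measure[OF assms(1)]
        borel_measurable_continuous_onI C1c_continuous[OF that])
  have "ennreal (LINT x:E|lebesgue. X_div X \<phi> x) \<le> X_perimeter X F U"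
    if U: "open U" "compactly_contained U \<Omega>" and F: "compactly_contained (sym_diff E F) U"
      and \<phi>: "\<phi> \<in> C1c U" "\<And>x. norm (\<phi> x) \<le> 1" for U F \<phi>
  proof -
    have U\<Omega>: "U \<subseteq> \<Omega>" using U closure_subset[of U] by (auto simp: compactly_contained_def)
    \<comment> \<open>A cutoff equal to \<open>1\<close> near \<open>K\<close> dominates
      \<open>norm (\<phi> x)\<close> and leaves the divergence of each \<open>\<nu> h\<close>
      unchanged on \<open>sym_diff E F\<close>.\<close>
    define K where "K = closure ({x. \<phi> x \<noteq> 0} \<union> sym_diff E F)"
    have "compactly_contained ({x. \<phi> x \<noteq> 0} \<union> sym_diff E F) U"
      using F \<phi>(1) by (intro compactly_contained_Un[of _ _ "sym_diff E F"]) (auto simp: C1c_def)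
    then have "compact K" "K \<subseteq> U" by (auto simp: compactly_contained_def K_def)
    then obtain V \<eta> where V: "open V" "K \<subseteq> V" and \<eta>: "\<eta> \<in> C1c U"
      "\<And>x. 0 \<le> \<eta> x \<and> \<eta> x \<le> (1::real)" "\<And>x. x \<in> V \<Longrightarrow> \<eta> x = 1"
      using C1_cutoff[OF _ U(1)] by metis
    have KV: "x \<in> V" if "\<phi> x \<noteq> 0 \<or> x \<in> sym_diff E F" for x
      using that V(2) closure_subset[of "{x. \<phi> x \<noteq> 0} \<union> sym_diff E F"]
      by (auto simp: K_def)
    have int: "integrable ?M \<eta>"
      by (rule integrable_C1c_X_perimeter_measure[OF assms(1,4) U \<eta>(1,2)])
    have "K \<subseteq> (\<Union>h\<in>{1..}. \<Omega>s h)" using \<open>K \<subseteq> U\<close> U\<Omega> assms(7) by simp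
    moreover have "open (\<Omega>s h) \<and> \<Omega>s h \<subseteq> \<Omega>s (Suc h)" if "h \<ge> 1" for h
      using assms(6)[OF that] closure_subset by (auto simp: compactly_contained_def)
    ultimately obtain h\<^sub>0 where h0: "h\<^sub>0 \<ge> 1" "\<And>h. h \<ge> h\<^sub>0 \<Longrightarrow> K \<subseteq> \<Omega>s h"
      using exhaustion_absorbs_compact[OF \<open>compact K\<close>] by metis
    define \<psi> where "\<psi> h x = \<eta> x *\<^sub>R \<nu> h x" for h x
    have \<psi>: "\<psi> h \<in> C1c U" and \<psi>le: "norm (\<psi> h x) \<le> \<eta> x" if "h \<ge> 1" for h x
    proof -
      show "\<psi> h \<in> C1c U" unfolding \<psi>_def
        using assms(1,8) that U\<Omega> by (intro C1c_scaleR[OF \<eta>(1)]) auto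
      \<comment> \<open>The bound on \<open>\<nu> h\<close> holds inside \<open>\<Omega>\<close>
        only; elsewhere the cutoff vanishes.\<close>
      have "\<eta> x \<noteq> 0 \<Longrightarrow> x \<in> \<Omega>"
        using \<eta>(1) U\<Omega> closure_subset[of "{x. \<eta> x \<noteq> 0}"]
        by (auto simp: C1c_def compactly_contained_def)
      then show "norm (\<psi> h x) \<le> \<eta> x"
        using assms(8)[OF that] \<eta>(2)[of x] mult_left_le[of "norm (\<nu> h x)" "\<eta> x"]
        by (cases "\<eta> x = 0") (auto simp: \<psi>_def)
    qed
    \<comment> \<open>The sign compensates for the minus in the Gauss formula, so that
      \<open>- \<psi> h\<close> produces the integral of
      \<open>\<psi> h x \<bullet> \<nu>\<^sub>E x\<close>.\<close>
    have neg: "(\<lambda>x. - \<psi> h x) \<in> C1c U" if "h \<ge> 1" for h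
      using C1c_scaleR[of "\<lambda>x. \<eta> x" U \<Omega> "\<lambda>x. (- 1) *\<^sub>R \<nu> h x"] \<eta>(1) assms(1,8) that U\<Omega>
        C1_on_scaleR[OF C1_on_const[of \<Omega> "-1"], of "\<nu> h"]
      by (simp add: \<psi>_def)
    \<comment> \<open>The integrands can differ only on \<open>sym_diff E F\<close>, which is
      contained in \<open>\<Omega>s h\<close> for \<open>h \<ge> h\<^sub>0\<close>. There the
      divergence of \<open>\<psi> h\<close> is that of \<open>\<nu> h\<close>, hence zero almost
      everywhere.\<close>
    have EF: "(LINT x:E|lebesgue. X_div X (\<lambda>x. - \<psi> h x) x) =
        (LINT x:F|lebesgue. X_div X (\<lambda>x. - \<psi> h x) x)" if h: "h \<ge> h\<^sub>0" for h
    proof -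
      have "AE x in lebesgue. x \<in> \<Omega>s h \<longrightarrow> X_div X (\<nu> h) x = 0"
        using assms(9) h h0 by auto
      then have "AE x in lebesgue. indicator E x *\<^sub>R X_div X (\<lambda>x. - \<psi> h x) x =
        indicator F x *\<^sub>R X_div X (\<lambda>x. - \<psi> h x) x"
      proof eventually_elim
        case (elim x)
        have "X_div X (\<lambda>x. - \<psi> h x) x = 0" if x: "x \<in> sym_diff E F"
        proof -
          have "x \<in> K" using x closure_subset[of "{x. \<phi> x \<noteq> 0} \<union> sym_diff E F"]
            by (auto simp: K_def)
          then have "X_div X (\<nu> h) x = 0" using elim h0(2)[OF h] by blast
          moreover have "X_div X (\<psi> h) x = X_div X (\<nu> h) x"
            using V(1) KV x \<eta>(3) by (intro X_div_cong_open[of V]) (auto simp: \<psi>_def)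
          ultimately show ?thesis by (simp add: X_div_minus)
        qed
        then show ?case by (auto simp: indicator_def)
      qed
      then show ?thesis unfolding set_lebesgue_integral_def by (rule lebesgue_integral_cong_AE)
    qed
    \<comment> \<open>The Gauss formula for \<open>E\<close> turns the flux into a divergence
      integral over \<open>E\<close>; this equals the one over \<open>F\<close>, where
      \<open>- \<psi> h\<close> is an admissible test field.\<close>
    have bound: "ennreal (LINT x|?M. \<psi> h x \<bullet> \<nu>\<^sub>E x) \<le> X_perimeter X F U" if h: "h \<ge> h\<^sub>0" for h
    proof -
      have h1: "h \<ge> 1" using h h0 by simp
      have "(LINT x|?M. \<psi> h x \<bullet> \<nu>\<^sub>E x) = (LINT x:F|lebesgue. X_div X (\<lambda>x. - \<psi> h x) x)"
        using Gauss[OF C1c_mono[OF neg[OF h1] U\<Omega>]] EF[OF h] by simp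
      moreover have "norm (- \<psi> h x) \<le> 1" for x
        using \<psi>le[OF h1, of x] \<eta>(2)[of x] by simp
      ultimately show ?thesis using X_perimeter_upper[OF neg[OF h1]] by simp
    qed
    \<comment> \<open>Dominated convergence with majorant \<open>\<eta>\<close>. The integrand tends
      to \<open>\<eta>\<close> because \<open>\<nu>\<^sub>E\<close> has unit length almost
      everywhere. The shift by \<open>h\<^sub>0\<close> keeps all indices at least \<open>1\<close>,
      as required for the bound on \<open>\<psi>\<close>.\<close>
    have "(\<lambda>h. LINT x|?M. \<psi> (h + h\<^sub>0) x \<bullet> \<nu>\<^sub>E x) \<longlonglongrightarrow> (LINT x|?M. \<eta> x)"
    proof (rule integral_dominated_convergence[where w=\<eta>])
      show "AE x in ?M. (\<lambda>h. \<psi> (h + h\<^sub>0) x \<bullet> \<nu>\<^sub>E x) \<longlonglongrightarrow> \<eta> x"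
        using assms(10) \<nu>E(2)
      proof eventually_elim
        case (elim x)
        have "(\<lambda>h. \<psi> (h + h\<^sub>0) x \<bullet> \<nu>\<^sub>E x) \<longlonglongrightarrow> (\<eta> x *\<^sub>R \<nu>\<^sub>E x) \<bullet> \<nu>\<^sub>E x"
          unfolding \<psi>_def by (intro tendsto_intros LIMSEQ_ignore_initial_segment elim)
        then show ?case using elim by (simp add: dot_square_norm)
      qed
      show "AE x in ?M. norm (\<psi> (h + h\<^sub>0) x \<bullet> \<nu>\<^sub>E x) \<le> \<eta> x" for h
        using \<nu>E(2)
      proof eventually_elim
        case (elim x)
        have "norm (\<psi> (h + h\<^sub>0) x \<bullet> \<nu>\<^sub>E x) \<le> norm (\<psi> (h + h\<^sub>0) x)"
          using Cauchy_Schwarz_ineq2[of "\<psi> (h + h\<^sub>0) x" "\<nu>\<^sub>E x"] elim by simp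
        then show ?case using \<psi>le[of "h + h\<^sub>0" x] h0 by simp
      qed
      show "(\<lambda>x. \<psi> (h + h\<^sub>0) x \<bullet> \<nu>\<^sub>E x) \<in> borel_measurable ?M" for h
        using meas[OF \<psi>] h0 by simp
    qed (use int in auto)
    then have "(\<lambda>h. ennreal (LINT x|?M. \<psi> (h + h\<^sub>0) x \<bullet> \<nu>\<^sub>E x)) \<longlonglongrightarrow> ennreal (LINT x|?M. \<eta> x)"
      by (rule tendsto_ennrealI)
    then have "ennreal (LINT x|?M. \<eta> x) \<le> X_perimeter X F U"
      by (rule LIMSEQ_le_const2) (use bound in auto)
    \<comment> \<open>Almost everywhere the flux density of \<open>\<phi>\<close> is at most
      \<open>norm (\<phi> x)\<close>, which is at most \<open>\<eta> x\<close> since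
      \<open>\<eta>\<close> is \<open>1\<close> wherever \<open>\<phi>\<close> is nonzero. Passing
      to norms absorbs the sign in the Gauss formula.\<close>
    moreover have "(LINT x:E|lebesgue. X_div X \<phi> x) \<le> (LINT x|?M. \<eta> x)"
    proof -
      have le: "AE x in ?M. norm (\<phi> x \<bullet> \<nu>\<^sub>E x) \<le> \<eta> x"
        using \<nu>E(2)
      proof eventually_elim
        case (elim x)
        have "norm (\<phi> x \<bullet> \<nu>\<^sub>E x) \<le> norm (\<phi> x)"
          using Cauchy_Schwarz_ineq2[of "\<phi> x" "\<nu>\<^sub>E x"] elim by simp
        also have "\<dots> \<le> \<eta> x"
          using \<phi>(2)[of x] \<eta>(2)[of x] \<eta>(3)[OF KV[of x]] by (cases "\<phi> x = 0") auto
        finally show ?case .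
      qed
      have "norm (LINT x|?M. \<phi> x \<bullet> \<nu>\<^sub>E x) \<le> (LINT x|?M. norm (\<phi> x \<bullet> \<nu>\<^sub>E x))"
        by (rule integral_norm_bound)
      also have "\<dots> \<le> (LINT x|?M. \<eta> x)"
        using int le \<eta>(2) by (intro integral_mono_AE') auto
      finally have "norm (LINT x|?M. \<phi> x \<bullet> \<nu>\<^sub>E x) \<le> (LINT x|?M. \<eta> x)" .
      then show ?thesis using Gauss[OF C1c_mono[OF \<phi>(1) U\<Omega>]] by simp
    qed
    ultimately show ?thesis by (meson ennreal_leI order_trans)
  qed
  then show ?thesis
    \<comment> \<open>Only the perimeter of \<open>E\<close> is expanded as a supremum; each of its
      test fields is covered by the inequality just proved.\<close>
    unfolding X_perimeter_minimizer_def by (auto simp: X_perimeter_def[of X E] intro!: SUP_least)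
qed

end
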